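(* Let $d\ge 0$ and let $\mathcal{F}$ be a graph class closed under taking subgraphs. If $\mathcal{F}$ is closed under weak oddomorphisms, then so is the class of all graphs $F$ with $\mathrm{ed}_{\mathcal{F}}(F)\le d$.
   Context: All graphs are finite, simple, undirected and loopless. The elimination distance $\mathrm{ed}_{\mathcal{F}}(F)$ of a graph $F$ to $\mathcal{F}$ is: $0$ if $F\in\mathcal{F}$; otherwise $1+\min_{v\in V(F)}\mathrm{ed}_{\mathcal{F}}(F-v)$ if $F$ is connected; and $\max_i\mathrm{ed}_{\mathcal{F}}(F_i)$ if $F$ is disconnected with connected components $F_i$. Let $\phi\colon F\to G$ be a homomorphism. A vertex $a\in V(F)$ is $\phi$-odd (resp. $\phi$-even) if $|N_F(a)\cap\phi^{-1}(v)|$ is odd (resp. even) for every $v\in N_G(\phi(a))$. $\phi$ is an oddomorphism if every vertex of $F$ is $\phi$-odd or $\phi$-even and every fibre $\phi^{-1}(v)$, $v\in V(G)$, contains an odd number of $\phi$-odd vertices. $\phi$ is a weak oddomorphism if its restriction to some subgraph $F'$ of $F$ is an oddomorphism $F'\to G$. A class $\mathcal{C}$ is closed under weak oddomorphisms if $F\in\mathcal{C}$ and a weak oddomorphism $F\to G$ imply $G\in\mathcal{C}$. *)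

theory Defs
  imports "Graph_Theory.Digraph_Component"
begin

text \<open>
  A finite simple undirected loopless graph is a \<^term>\<open>pair_graph\<close>: a finite set of vertices with
  a symmetric irreflexive arc relation on it, an edge \<open>{u, v}\<close> being the two arcs \<open>(u, v)\<close> and
  \<open>(v, u)\<close>. The empty graph is allowed. A subgraph has to be a \<^term>\<open>pair_graph\<close> itself, as the
  library relation \<^term>\<open>subgraph\<close> alone could drop one of the two arcs of an edge.
\<close>

definition is_subgraph :: "'a pair_pre_digraph \<Rightarrow> 'a pair_pre_digraph \<Rightarrow> bool" where
  "is_subgraph H G \<longleftrightarrow> pair_graph H \<and> pair_graph G \<and> subgraph (with_proj H) (with_proj G)"

definition neighbourhood :: "'a pair_pre_digraph \<Rightarrow> 'a \<Rightarrow> 'a set" where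
  "neighbourhood G v = {u. (v, u) \<in> parcs G}"

definition delete_vertex :: "'a pair_pre_digraph \<Rightarrow> 'a \<Rightarrow> 'a pair_pre_digraph" where
  "delete_vertex G v =
    \<lparr>pverts = pverts G - {v}, parcs = {e \<in> parcs G. fst e \<noteq> v \<and> snd e \<noteq> v}\<rparr>"

lemma with_proj_delete_vertex:
  "with_proj (delete_vertex G v) = pre_digraph.del_vert (with_proj G) v"
  by (simp add: delete_vertex_def pre_digraph.del_vert_def with_proj_def)

lemma card_delete_vertex_less:
  assumes "pair_graph G" "v \<in> pverts G"
  shows "card (pverts (delete_vertex G v)) < card (pverts G)"
proof -
  interpret pair_graph G by fact
  show ?thesis
    using pair_finite_verts assms(2) by (simp add: delete_vertex_def card_Diff1_less del: card_Diff_insert)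
qed

definition components :: "'a pair_pre_digraph \<Rightarrow> 'a pair_pre_digraph set" where
  "components G = {H. pair_graph H \<and> pre_digraph.max_subgraph (with_proj G) connected (with_proj H)}"

lemma card_component_less:
  assumes "pair_graph G" "\<not> connected (with_proj G)" "H \<in> components G"
  shows "card (pverts H) < card (pverts G)"
proof -
  interpret pair_graph G by fact
  have sub: "subgraph (with_proj H) (with_proj G)" and con: "connected (with_proj H)"
    using assms(3) by (auto simp: components_def pre_digraph.max_subgraph_def)
  have "pverts H \<subseteq> pverts G"
    using subgraph_imp_subverts[OF sub] by simp
  moreover have "pverts H \<noteq> pverts G"
  proof
    assume "pverts H = pverts G"
    then have "spanning (with_proj H) (with_proj G)"
      using sub by (simp add: spanning_def)
    then show False
      using connected_spanning_imp_connected con assms(2) by blast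
  qed
  ultimately show ?thesis
    using pair_finite_verts by (simp add: psubset_card_mono psubset_eq)
qed

text \<open>
  \<^term>\<open>connected\<close> excludes the empty graph, which has no components either. If the empty graph
  is not in \<open>\<F>\<close> it gets the value 0, the maximum over no components. For a subgraph-closed \<open>\<F>\<close>
  this happens only if \<open>\<F>\<close> is empty, and the elimination distance is then the tree-depth.
  The value at a record that is not a graph is immaterial.
\<close>

function elim_dist :: "'a pair_pre_digraph set \<Rightarrow> 'a pair_pre_digraph \<Rightarrow> nat" where
  "elim_dist \<F> F =
    (if \<not> pair_graph F then undefined
     else if F \<in> \<F> \<or> pverts F = {} then 0
     else if connected (with_proj F) then 1 + (MIN v\<in>pverts F. elim_dist \<F> (delete_vertex F v))
     else (MAX H\<in>components F. elim_dist \<F> H))"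
  by pat_completeness auto
termination
  by (relation "measure (\<lambda>(\<F>, F). card (pverts F))")
    (auto intro: card_delete_vertex_less card_component_less)

declare elim_dist.simps [simp del]

definition graph_hom :: "'a pair_pre_digraph \<Rightarrow> 'b pair_pre_digraph \<Rightarrow> ('a \<Rightarrow> 'b) \<Rightarrow> bool" where
  "graph_hom F G \<phi> \<longleftrightarrow> pair_graph F \<and> pair_graph G \<and> (\<forall>a\<in>pverts F. \<phi> a \<in> pverts G) \<and>
    (\<forall>a b. (a, b) \<in> parcs F \<longrightarrow> (\<phi> a, \<phi> b) \<in> parcs G)"

definition fibre :: "'a pair_pre_digraph \<Rightarrow> ('a \<Rightarrow> 'b) \<Rightarrow> 'b \<Rightarrow> 'a set" where
  "fibre F \<phi> v = {a \<in> pverts F. \<phi> a = v}"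

definition hom_odd :: "'a pair_pre_digraph \<Rightarrow> 'b pair_pre_digraph \<Rightarrow> ('a \<Rightarrow> 'b) \<Rightarrow> 'a \<Rightarrow> bool" where
  "hom_odd F G \<phi> a \<longleftrightarrow>
    (\<forall>v\<in>neighbourhood G (\<phi> a). odd (card (neighbourhood F a \<inter> fibre F \<phi> v)))"

definition hom_even :: "'a pair_pre_digraph \<Rightarrow> 'b pair_pre_digraph \<Rightarrow> ('a \<Rightarrow> 'b) \<Rightarrow> 'a \<Rightarrow> bool" where
  "hom_even F G \<phi> a \<longleftrightarrow>
    (\<forall>v\<in>neighbourhood G (\<phi> a). even (card (neighbourhood F a \<inter> fibre F \<phi> v)))"

definition oddomorphism :: "'a pair_pre_digraph \<Rightarrow> 'b pair_pre_digraph \<Rightarrow> ('a \<Rightarrow> 'b) \<Rightarrow> bool" where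
  "oddomorphism F G \<phi> \<longleftrightarrow> graph_hom F G \<phi> \<and>
    (\<forall>a\<in>pverts F. hom_odd F G \<phi> a \<or> hom_even F G \<phi> a) \<and>
    (\<forall>v\<in>pverts G. odd (card {a \<in> fibre F \<phi> v. hom_odd F G \<phi> a}))"

text \<open>
  Only the values of \<open>\<phi>\<close> on the vertices of its domain graph matter in \<^term>\<open>oddomorphism\<close>,
  so the restriction of \<open>\<phi>\<close> to \<open>F'\<close> is again written \<open>\<phi>\<close>.
\<close>

definition weak_oddomorphism ::
  "'a pair_pre_digraph \<Rightarrow> 'b pair_pre_digraph \<Rightarrow> ('a \<Rightarrow> 'b) \<Rightarrow> bool" where
  "weak_oddomorphism F G \<phi> \<longleftrightarrow> graph_hom F G \<phi> \<and> (\<exists>F'. is_subgraph F' F \<and> oddomorphism F' G \<phi>)"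

definition graph_class :: "'a pair_pre_digraph set \<Rightarrow> bool" where
  "graph_class \<C> \<longleftrightarrow> (\<forall>F\<in>\<C>. pair_graph F)"

definition subgraph_closed :: "'a pair_pre_digraph set \<Rightarrow> bool" where
  "subgraph_closed \<C> \<longleftrightarrow> (\<forall>F H. F \<in> \<C> \<and> is_subgraph H F \<longrightarrow> H \<in> \<C>)"

text \<open>
  An isomorphism is an oddomorphism, so this closure property includes closure under isomorphism.
\<close>

definition weak_oddomorphism_closed :: "'a pair_pre_digraph set \<Rightarrow> bool" where
  "weak_oddomorphism_closed \<C> \<longleftrightarrow>
    (\<forall>F G. F \<in> \<C> \<and> (\<exists>\<phi>. weak_oddomorphism F G \<phi>) \<longrightarrow> G \<in> \<C>)"

end

theory Submission
  imports Defs
begin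

text \<open>
  Fix the set \<open>A\<close> of odd vertices of an oddomorphism \<open>F \<rightarrow> G\<close> as extra data. Such a labelled
  oddomorphism restricts to the preimage of any vertex set of \<open>G\<close>; without the labels this fails,
  because a vertex over an isolated vertex of \<open>G\<close> is both odd and even. Moreover, double counting the
  edges between two fibres shows that on any union of connected components of \<open>F\<close> the parity of the
  number of odd vertices in a fibre is the same for all fibres over a connected \<open>G\<close>; hence some
  component of \<open>F\<close> carries a labelled oddomorphism to \<open>G\<close>. Consequently an elimination of \<open>F\<close> can be
  imitated on \<open>G\<close>: when \<open>v\<close> is deleted from \<open>F\<close>, delete \<open>\<phi> v\<close> from \<open>G\<close> and its whole fibre from the
  subgraph of \<open>F\<close>.
\<close>

section \<open>Induced subgraphs and components\<close>

text \<open>Trades the locale hierarchy for set conditions that automation can use. The arcs are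
  finitely many because they are pairs of vertices.\<close>

lemma pair_graph_iff:
  "pair_graph G \<longleftrightarrow> finite (pverts G) \<and> parcs G \<subseteq> pverts G \<times> pverts G \<and> sym (parcs G) \<and> irrefl (parcs G)"
proof
  assume "pair_graph G"
  then interpret pair_graph G .
  show "finite (pverts G) \<and> parcs G \<subseteq> pverts G \<times> pverts G \<and> sym (parcs G) \<and> irrefl (parcs G)"
    using pair_finite_verts in_arcsD1 in_arcsD2 arcs_symmetric
    by (auto simp: sym_def irrefl_def dest: no_loops')
next
  assume r: "finite (pverts G) \<and> parcs G \<subseteq> pverts G \<times> pverts G \<and> sym (parcs G) \<and> irrefl (parcs G)"
  then have "finite (parcs G)"
    by (meson finite_SigmaI finite_subset)
  with r show "pair_graph G"
    by unfold_locales (auto simp: symmetric_def irrefl_def)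
qed

lemma is_subgraph_iff:
  "is_subgraph H G \<longleftrightarrow>
    pair_graph H \<and> pair_graph G \<and> pverts H \<subseteq> pverts G \<and> parcs H \<subseteq> parcs G"
  by (auto simp: is_subgraph_def subgraph_def compatible_def wf_digraph_wp_iff pair_graph_def
      pair_digraph_def pair_fin_digraph_def)

text \<open>\<open>S\<close> may contain non-vertices, so complements and preimages under a
  homomorphism can serve directly.\<close>

definition induced :: "'a pair_pre_digraph \<Rightarrow> 'a set \<Rightarrow> 'a pair_pre_digraph" where
  "induced G S = \<lparr>pverts = pverts G \<inter> S, parcs = parcs G \<inter> S \<times> S\<rparr>"

lemma induced_simps [simp]:
  "pverts (induced G S) = pverts G \<inter> S"
  "parcs (induced G S) = parcs G \<inter> S \<times> S"
  by (simp_all add: induced_def)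

lemma pair_graph_induced:
  "pair_graph G \<Longrightarrow> pair_graph (induced G S)"
  by (auto simp: pair_graph_iff sym_def irrefl_def)

lemma is_subgraph_induced:
  "pair_graph G \<Longrightarrow> is_subgraph (induced G S) G"
  by (auto simp: is_subgraph_iff pair_graph_induced)

lemma delete_vertex_eq_induced:
  "pair_graph G \<Longrightarrow> delete_vertex G v = induced G (- {v})"
  by (auto simp: delete_vertex_def induced_def)

text \<open>\<open>connected\<close> refers to the symmetric closure of the arcs of
  \<open>H\<close>, which the symmetric relation \<open>parcs G\<close> contains. \<open>H\<close>
  is an arbitrary digraph because \<open>max_subgraph\<close> ranges over those.\<close>

lemma connected_subgraph_imp_reachable:
  assumes "pair_graph G" "subgraph H (with_proj G)" "connected H" "u \<in> verts H" "v \<in> verts H"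
  shows "(u, v) \<in> (parcs G)\<^sup>*"
proof -
  interpret pair_graph G by fact
  have "arcs_ends H \<subseteq> parcs G"
    using arcs_ends_mono[OF assms(2)] by simp
  then have "(arcs_ends H)\<^sup>s \<subseteq> parcs G"
    using arcs_symmetric by (auto simp: symcl_def)
  moreover have "(u, v) \<in> rtrancl_on (verts H) ((arcs_ends H)\<^sup>s)"
    using assms by (simp add: connected_conv)
  ultimately show ?thesis
    by (meson rtrancl_mono rtrancl_on_rtranclI subsetD)
qed

lemma connected_induced_reachable:
  assumes "pair_graph G" "u \<in> pverts G"
  shows "connected (with_proj (induced G ((parcs G)\<^sup>* `` {u})))" (is "connected (with_proj ?C)")
proof -
  interpret C: pair_graph ?C
    by (intro pair_graph_induced assms)
  have reach: "u \<rightarrow>\<^sup>*\<^bsub>with_proj ?C\<^esub> v" if "(u, v) \<in> (parcs G)\<^sup>*" for v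
    using that
  proof induction
    case base
    then show ?case using assms by auto
  next
    case (step y z)
    then have "(y, z) \<in> parcs ?C" by auto
    then show ?case using step.IH C.reachable_adj_trans by auto
  qed
  show ?thesis
  proof (rule C.connectedI)
    show "pverts ?C \<noteq> {}"
      using assms by auto
    fix a b
    assume "a \<in> pverts ?C" "b \<in> pverts ?C"
    then have "u \<rightarrow>\<^sup>*\<^bsub>with_proj ?C\<^esub> a" "u \<rightarrow>\<^sup>*\<^bsub>with_proj ?C\<^esub> b"
      using reach by auto
    then have "a \<rightarrow>\<^sup>*\<^bsub>with_proj ?C\<^esub> b"
      by (blast intro: C.reachable_trans C.symmetric_reachable')
    then show "a \<rightarrow>\<^sup>*\<^bsub>with_proj (mk_symmetric (with_proj ?C))\<^esub> b"
      by (rule C.reachable_mk_symmetricI)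
  qed
qed

text \<open>A connected subgraph through \<open>u\<close> has only vertices reachable from
  \<open>u\<close>, so the graph induced on these is the greatest such subgraph.\<close>

lemma max_connected_induced_reachable:
  assumes "pair_graph G" "u \<in> pverts G"
  shows "pre_digraph.max_subgraph (with_proj G) connected
    (with_proj (induced G ((parcs G)\<^sup>* `` {u})))" (is "pre_digraph.max_subgraph _ _ (with_proj ?C)")
    and "subgraph H (with_proj G) \<Longrightarrow> connected H \<Longrightarrow> u \<in> verts H \<Longrightarrow>
      subgraph H (with_proj (induced G ((parcs G)\<^sup>* `` {u})))"
proof -
  interpret pair_graph G by fact
  have sub: "subgraph H (with_proj ?C)"
    if H: "subgraph H (with_proj G)" "connected H" "u \<in> verts H" for H
  proof -
    interpret H: wf_digraph H
      using H by blast
    have v: "verts H \<subseteq> pverts ?C"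
      using connected_subgraph_imp_reachable[OF assms(1) H] subgraph_imp_subverts[OF H(1)] by auto
    have [simp]: "tail H = fst" "head H = snd"
      using H(1) by (auto simp: subgraph_def compatible_def)
    have "arcs H \<subseteq> parcs ?C"
    proof
      fix e
      assume e: "e \<in> arcs H"
      then have "e \<in> parcs G" "fst e \<in> verts H" "snd e \<in> verts H"
        using H(1) H.wellformed[OF e] by (auto simp: subgraph_def)
      with v show "e \<in> parcs ?C"
        by (cases e) auto
    qed
    then show ?thesis
      using v pair_graph_induced[OF assms(1)] H.wf_digraph_axioms
      by (auto simp: subgraph_def compatible_def wf_digraph_wp_iff pair_graph_def
          pair_digraph_def pair_fin_digraph_def)
  qed
  then show "subgraph H (with_proj G) \<Longrightarrow> connected H \<Longrightarrow> u \<in> verts H \<Longrightarrow> subgraph H (with_proj ?C)" .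
  show "max_subgraph connected (with_proj ?C)"
  proof (rule max_subgraphI)
    show "connected (with_proj ?C)"
      by (rule connected_induced_reachable[OF assms])
    show "subgraph (with_proj ?C) (with_proj G)"
      using is_subgraph_induced[OF assms(1)] by (simp add: is_subgraph_def)
    fix H
    assume H: "with_proj ?C \<noteq> H" "subgraph (with_proj ?C) H" "subgraph H (with_proj G)"
    have "u \<in> verts H"
      using subgraph_imp_subverts[OF H(2)] assms by auto
    then have "connected H \<Longrightarrow> subgraph H (with_proj ?C)"
      using sub[OF H(3)] by simp
    moreover have "\<not> subgraph H (with_proj ?C)"
      using H(1,2) by (auto simp: subgraph_def compatible_def intro!: pre_digraph.equality)
    ultimately show "\<not> connected H"
      by blast
  qed
qed

lemma with_proj_eq_iff: "with_proj G = with_proj H \<longleftrightarrow> G = H"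
  by (auto simp: with_proj_def)

text \<open>A component lies below the reachability class of any of its vertices, which is itself
  connected, so maximality forces equality.\<close>

lemma component_eq_induced:
  assumes "pair_graph G" "C \<in> components G" "u \<in> pverts C"
  shows "C = induced G ((parcs G)\<^sup>* `` {u})"
proof -
  have C: "pre_digraph.max_subgraph (with_proj G) connected (with_proj C)"
    using assms by (simp add: components_def)
  then have sub: "subgraph (with_proj C) (with_proj G)" "connected (with_proj C)"
    by (auto simp: pre_digraph.max_subgraph_def)
  with assms have "u \<in> pverts G"
    using subgraph_imp_subverts by fastforce
  with max_connected_induced_reachable[OF assms(1) this] C sub assms(3) show ?thesis
    by (metis pre_digraph.max_subgraph_subg_eq with_proj_eq_iff with_proj_simps(1))
qed

lemma induced_reachable_in_components:
  "pair_graph G \<Longrightarrow> u \<in> pverts G \<Longrightarrow> induced G ((parcs G)\<^sup>* `` {u}) \<in> components G"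
  by (simp add: components_def max_connected_induced_reachable pair_graph_induced)

text \<open>That no edge leaves a component is what later keeps neighbour counts unchanged on
  passing to it.\<close>

lemma componentD:
  assumes "pair_graph G" "C \<in> components G"
  shows "pair_graph C" "pverts C \<noteq> {}" "pverts C \<subseteq> pverts G" "C = induced G (pverts C)"
    and "\<And>a b. (a, b) \<in> parcs G \<Longrightarrow> a \<in> pverts C \<longleftrightarrow> b \<in> pverts C"
proof -
  show "pair_graph C" "pverts C \<noteq> {}"
    using assms by (auto simp: components_def pre_digraph.max_subgraph_def connected_conv)
  then obtain u where u: "u \<in> pverts C" by auto
  note C = component_eq_induced[OF assms u]
  have G: "sym (parcs G)" "parcs G \<subseteq> pverts G \<times> pverts G"
    using assms by (auto simp: pair_graph_iff)
  show "pverts C \<subseteq> pverts G"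
    by (subst C) auto
  show "C = induced G (pverts C)"
    using G(2) arg_cong[OF C, of pverts] by (subst C) (auto simp: induced_def)
  show "a \<in> pverts C \<longleftrightarrow> b \<in> pverts C" if "(a, b) \<in> parcs G" for a b
  proof -
    have "(b, a) \<in> parcs G"
      using that G by (auto dest: symD)
    with that G show ?thesis
      by (subst (1 2) C) (auto intro: rtrancl_into_rtrancl)
  qed
qed

lemma finite_components:
  assumes "pair_graph G"
  shows "finite (components G)"
proof (rule finite_subset)
  show "components G \<subseteq> induced G ` Pow (pverts G)"
    using componentD[OF assms] by blast
  show "finite (induced G ` Pow (pverts G))"
    using assms by (simp add: pair_graph_iff)
qed

lemma components_disjoint:
  assumes "pair_graph G" "C \<in> components G" "D \<in> components G" "C \<noteq> D"
  shows "pverts C \<inter> pverts D = {}"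
proof (rule equals0I)
  fix u
  assume "u \<in> pverts C \<inter> pverts D"
  then have "C = D"
    using component_eq_induced[OF assms(1,2), of u] component_eq_induced[OF assms(1,3), of u] by simp
  with assms(4) show False
    by contradiction
qed

lemma Union_components:
  assumes "pair_graph G"
  shows "(\<Union>C\<in>components G. pverts C) = pverts G"
proof
  show "(\<Union>C\<in>components G. pverts C) \<subseteq> pverts G"
    using componentD(3)[OF assms] by (rule UN_least)
  show "pverts G \<subseteq> (\<Union>C\<in>components G. pverts C)"
  proof
    fix u
    assume u: "u \<in> pverts G"
    then show "u \<in> (\<Union>C\<in>components G. pverts C)"
      by (intro UN_I[OF induced_reachable_in_components[OF assms u]]) simp
  qed
qed

section \<open>Bounds on the elimination distance\<close>

lemma elim_dist_eq_0:
  "pair_graph F \<Longrightarrow> F \<in> \<F> \<or> pverts F = {} \<Longrightarrow> elim_dist \<F> F = 0"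
  by (simp add: elim_dist.simps)

lemma elim_dist_connected_leD:
  assumes "pair_graph F" "F \<notin> \<F>" "connected (with_proj F)" "elim_dist \<F> F \<le> d"
  obtains v where "v \<in> pverts F" "Suc (elim_dist \<F> (delete_vertex F v)) \<le> d"
proof -
  let ?D = "(\<lambda>v. elim_dist \<F> (delete_vertex F v)) ` pverts F"
  have ne: "pverts F \<noteq> {}" "finite (pverts F)"
    using assms by (auto simp: connected_conv pair_graph_iff)
  then have "Min ?D \<in> ?D"
    by (intro Min_in) auto
  then obtain v where "v \<in> pverts F" "Min ?D = elim_dist \<F> (delete_vertex F v)"
    by auto
  with assms ne show thesis
    by (intro that[of v]) (simp_all add: elim_dist.simps[of \<F> F])
qed

lemma elim_dist_connected_leI:
  assumes "pair_graph F" "connected (with_proj F)" "v \<in> pverts F"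
    and "Suc (elim_dist \<F> (delete_vertex F v)) \<le> d"
  shows "elim_dist \<F> F \<le> d"
proof -
  have "(MIN v\<in>pverts F. elim_dist \<F> (delete_vertex F v)) \<le> elim_dist \<F> (delete_vertex F v)"
    using assms by (intro Min_le) (auto simp: pair_graph_iff)
  then show ?thesis
    using assms by (simp add: elim_dist.simps[of \<F> F])
qed

lemma elim_dist_component_le:
  assumes "pair_graph F" "F \<notin> \<F>" "pverts F \<noteq> {}" "\<not> connected (with_proj F)" "C \<in> components F"
  shows "elim_dist \<F> C \<le> elim_dist \<F> F"
  using assms finite_components[OF assms(1)] by (simp add: elim_dist.simps[of \<F> F])

lemma elim_dist_disconnected_leI:
  assumes "pair_graph F" "\<not> connected (with_proj F)"
    and "\<And>C. C \<in> components F \<Longrightarrow> elim_dist \<F> C \<le> d"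
  shows "elim_dist \<F> F \<le> d"
proof (cases "F \<in> \<F> \<or> pverts F = {}")
  case True
  then show ?thesis using assms(1) by (simp add: elim_dist_eq_0)
next
  case False
  \<comment> \<open>\<open>Max\<close> needs a nonempty set; any vertex of the nonempty
    \<open>F\<close> provides a component.\<close>
  then have "components F \<noteq> {}"
    using Union_components[OF assms(1)] by auto
  then show ?thesis
    using False assms finite_components[OF assms(1)] by (simp add: elim_dist.simps[of \<F> F])
qed

section \<open>Labelled oddomorphisms\<close>

text \<open>Over an isolated vertex of \<open>G\<close> the condition is vacuous and
  \<open>A\<close> is free. The odd fibres are demanded separately: restriction to a component can
  destroy them, while the labelling survives.\<close>

definition parity_labelling ::
  "'a pair_pre_digraph \<Rightarrow> 'b pair_pre_digraph \<Rightarrow> ('a \<Rightarrow> 'b) \<Rightarrow> 'a set \<Rightarrow> bool" where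
  "parity_labelling H G \<phi> A \<longleftrightarrow> graph_hom H G \<phi> \<and>
    (\<forall>a\<in>pverts H. \<forall>v\<in>neighbourhood G (\<phi> a).
      odd (card (neighbourhood H a \<inter> fibre H \<phi> v)) \<longleftrightarrow> a \<in> A)"

definition labelled_oddomorphism ::
  "'a pair_pre_digraph \<Rightarrow> 'b pair_pre_digraph \<Rightarrow> ('a \<Rightarrow> 'b) \<Rightarrow> 'a set \<Rightarrow> bool" where
  "labelled_oddomorphism H G \<phi> A \<longleftrightarrow> parity_labelling H G \<phi> A \<and>
    (\<forall>v\<in>pverts G. odd (card (A \<inter> fibre H \<phi> v)))"

lemma oddomorphism_imp_labelled:
  assumes "oddomorphism H G \<phi>"
  shows "labelled_oddomorphism H G \<phi> {a. hom_odd H G \<phi> a}"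
proof -
  have "{a. hom_odd H G \<phi> a} \<inter> fibre H \<phi> v = {a \<in> fibre H \<phi> v. hom_odd H G \<phi> a}" for v
    by auto
  then show ?thesis
    using assms unfolding labelled_oddomorphism_def parity_labelling_def oddomorphism_def
    by (simp, auto simp: hom_odd_def hom_even_def)
qed

text \<open>The edges of \<open>H\<close> between the two fibres are counted from either side. On
  each side exactly the vertices in \<open>A\<close> contribute odd numbers, so the total has the
  parity of their number.\<close>

lemma parity_labelling_odd_fibre_adjacent:
  assumes "parity_labelling H G \<phi> A" "(u, v) \<in> parcs G"
  shows "odd (card (A \<inter> fibre H \<phi> u)) \<longleftrightarrow> odd (card (A \<inter> fibre H \<phi> v))"
proof -
  have H: "pair_graph H" "pair_graph G"
    using assms by (auto simp: parity_labelling_def graph_hom_def)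
  have fin: "finite (fibre H \<phi> x)" for x
    using H by (auto simp: fibre_def pair_graph_iff)
  have flip: "(v, u) \<in> parcs G" "sym (parcs H)"
    using H assms(2) by (auto simp: pair_graph_iff dest: symD)
  have odd_iff: "odd (\<Sum>a\<in>fibre H \<phi> x. card (neighbourhood H a \<inter> fibre H \<phi> y)) \<longleftrightarrow>
      odd (card (A \<inter> fibre H \<phi> x))" if "(x, y) \<in> parcs G" for x y
  proof -
    have "{a \<in> fibre H \<phi> x. odd (card (neighbourhood H a \<inter> fibre H \<phi> y))} = A \<inter> fibre H \<phi> x"
      using that assms(1) by (auto simp: parity_labelling_def fibre_def neighbourhood_def)
    then show ?thesis
      using fin by (simp add: even_sum_iff)
  qed
  \<comment> \<open>Both orientations of an edge are recorded, so that the two sums below use the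
    same relation and \<open>sum.swap_restrict\<close> applies.\<close>
  have nb: "neighbourhood H a \<inter> fibre H \<phi> y = {b \<in> fibre H \<phi> y. (a, b) \<in> parcs H}"
    "neighbourhood H a \<inter> fibre H \<phi> y = {b \<in> fibre H \<phi> y. (b, a) \<in> parcs H}" for a y
    using flip by (auto simp: neighbourhood_def dest: symD)
  have "(\<Sum>a\<in>fibre H \<phi> u. card (neighbourhood H a \<inter> fibre H \<phi> v)) =
      (\<Sum>b\<in>fibre H \<phi> v. card (neighbourhood H b \<inter> fibre H \<phi> u))"
    unfolding nb(1)[of _ v] nb(2)[of _ u] card_eq_sum by (rule sum.swap_restrict[OF fin fin])
  then show ?thesis
    using odd_iff[OF assms(2)] odd_iff[OF flip(1)] by simp
qed

lemma parity_labelling_odd_fibre_connected: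
  assumes "parity_labelling H G \<phi> A" "connected (with_proj G)" "u \<in> pverts G" "v \<in> pverts G"
  shows "odd (card (A \<inter> fibre H \<phi> u)) \<longleftrightarrow> odd (card (A \<inter> fibre H \<phi> v))"
proof -
  have G: "pair_graph G"
    using assms by (auto simp: parity_labelling_def graph_hom_def)
  then interpret pair_graph G .
  have "(u, v) \<in> (parcs G)\<^sup>*"
    using connected_subgraph_imp_reachable[OF G, of "with_proj G"] assms subgraph_refl by simp
  then show ?thesis
    by induction (use parity_labelling_odd_fibre_adjacent[OF assms(1)] in auto)
qed

text \<open>Fibres over \<open>S\<close> stay whole, and \<open>induced G S\<close> asks only for
  counts into such fibres. As \<open>A\<close> is fixed, a vertex whose image becomes isolated keeps
  its label.\<close>

lemma labelled_oddomorphism_vimage: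
  assumes "labelled_oddomorphism H G \<phi> A"
  shows "labelled_oddomorphism (induced H (\<phi> -` S)) (induced G S) \<phi> A"
proof -
  let ?H = "induced H (\<phi> -` S)"
  have hom: "graph_hom H G \<phi>"
    using assms by (simp add: labelled_oddomorphism_def parity_labelling_def)
  then have "graph_hom ?H (induced G S) \<phi>"
    by (auto simp: graph_hom_def pair_graph_induced)
  moreover have "fibre ?H \<phi> v = fibre H \<phi> v" if "v \<in> S" for v
    using that by (auto simp: fibre_def)
  moreover have "neighbourhood ?H a \<inter> fibre H \<phi> v = neighbourhood H a \<inter> fibre H \<phi> v"
    if "\<phi> a \<in> S" "v \<in> S" for a v
    using that by (auto simp: neighbourhood_def fibre_def)
  ultimately show ?thesis
    using assms by (auto simp: labelled_oddomorphism_def parity_labelling_def neighbourhood_def)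
qed

text \<open>Components are taken in \<open>F\<close>, where the elimination proceeds; no edge of
  \<open>H\<close> leaves one, so the labelling restricts. The odd count over one vertex
  \<open>w\<close> is a sum over components, so some summand is odd, and connectedness of
  \<open>G\<close> spreads this to all fibres.\<close>

lemma labelled_oddomorphism_component:
  assumes "labelled_oddomorphism H G \<phi> A" "is_subgraph H F" "connected (with_proj G)"
  obtains C where "C \<in> components F" "labelled_oddomorphism (induced H (pverts C)) G \<phi> A"
proof -
  have F: "pair_graph F" "pair_graph H" "pverts H \<subseteq> pverts F" "parcs H \<subseteq> parcs F"
    using assms(2) by (auto simp: is_subgraph_iff)
  have lab: "parity_labelling (induced H (pverts C)) G \<phi> A" if C: "C \<in> components F" for C
  proof -
    let ?H = "induced H (pverts C)"
    have nb: "neighbourhood ?H a = neighbourhood H a"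
      "neighbourhood H a \<inter> fibre ?H \<phi> v = neighbourhood H a \<inter> fibre H \<phi> v" if "a \<in> pverts C" for a v
      using that componentD(5)[OF F(1) C] F(4) by (auto simp: neighbourhood_def fibre_def)
    show ?thesis
      using assms(1) pair_graph_induced nb
      by (auto simp: labelled_oddomorphism_def parity_labelling_def graph_hom_def)
  qed
  obtain w where w: "w \<in> pverts G"
    using assms(3) by (auto simp: connected_conv)
  let ?X = "\<lambda>C. A \<inter> fibre (induced H (pverts C)) \<phi> w"
  have "A \<inter> fibre H \<phi> w = (\<Union>C\<in>components F. ?X C)"
    using Union_components[OF F(1)] F(3) by (auto simp: fibre_def)
  also have "card \<dots> = (\<Sum>C\<in>components F. card (?X C))"
  proof (rule card_UN_disjoint[OF finite_components[OF F(1)]])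
    show "\<forall>C\<in>components F. finite (?X C)"
      using F(2) by (auto simp: fibre_def pair_graph_iff)
    show "\<forall>C\<in>components F. \<forall>D\<in>components F. C \<noteq> D \<longrightarrow> ?X C \<inter> ?X D = {}"
      using components_disjoint[OF F(1)] by (fastforce simp: fibre_def)
  qed
  finally have "odd (\<Sum>C\<in>components F. card (?X C))"
    using assms(1) w by (metis labelled_oddomorphism_def)
  then obtain C where C: "C \<in> components F" "odd (card (?X C))"
    by (meson dvd_sum)
  then show thesis
    using that lab[OF C(1)] parity_labelling_odd_fibre_connected[OF lab[OF C(1)] assms(3) w]
    by (auto simp: labelled_oddomorphism_def)
qed

text \<open>
  Over an isolated vertex of \<open>G\<close> every vertex is odd, so the fibre is cut down to a single vertex.
\<close>

lemma labelled_oddomorphism_imp_weak_oddomorphism: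
  assumes "labelled_oddomorphism H G \<phi> A"
  shows "weak_oddomorphism H G \<phi>"
proof -
  have hom: "graph_hom H G \<phi>"
    and lab: "\<And>a v. a \<in> pverts H \<Longrightarrow> v \<in> neighbourhood G (\<phi> a) \<Longrightarrow>
      odd (card (neighbourhood H a \<inter> fibre H \<phi> v)) \<longleftrightarrow> a \<in> A"
    and odd_fibre: "\<And>v. v \<in> pverts G \<Longrightarrow> odd (card (A \<inter> fibre H \<phi> v))"
    using assms by (auto simp: labelled_oddomorphism_def parity_labelling_def)
  have graphs: "pair_graph H" "pair_graph G"
    using hom by (auto simp: graph_hom_def)
  have "\<forall>v\<in>pverts G. \<exists>a. a \<in> fibre H \<phi> v"
    using odd_fibre by (metis Int_iff card.empty equals0I even_zero)
  then obtain s where s: "\<And>v. v \<in> pverts G \<Longrightarrow> s v \<in> fibre H \<phi> v"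
    by metis
  define S where "S = {a. neighbourhood G (\<phi> a) \<noteq> {} \<or> a = s (\<phi> a)}"
  let ?H = "induced H S"
  have nonisolated: "neighbourhood G (\<phi> a) \<noteq> {}" "neighbourhood G (\<phi> b) \<noteq> {}"
    if "(a, b) \<in> parcs H" for a b
  proof -
    have "(\<phi> a, \<phi> b) \<in> parcs G" "(\<phi> b, \<phi> a) \<in> parcs G"
      using that hom graphs(2) by (auto simp: graph_hom_def pair_graph_iff dest: symD)
    then show "neighbourhood G (\<phi> a) \<noteq> {}" "neighbourhood G (\<phi> b) \<noteq> {}"
      by (auto simp: neighbourhood_def)
  qed
  \<comment> \<open>Vertices outside \<open>S\<close> lie over isolated vertices of
    \<open>G\<close>, hence are isolated in \<open>H\<close>, and no neighbour count
    changes.\<close>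
  have nb: "neighbourhood ?H a \<inter> fibre ?H \<phi> v = neighbourhood H a \<inter> fibre H \<phi> v" for a v
    using nonisolated by (auto simp: neighbourhood_def fibre_def S_def)
  have odd_iff: "hom_odd ?H G \<phi> a \<longleftrightarrow> neighbourhood G (\<phi> a) = {} \<or> a \<in> A"
    and even_iff: "hom_even ?H G \<phi> a \<longleftrightarrow> neighbourhood G (\<phi> a) = {} \<or> a \<notin> A"
    if "a \<in> pverts H" for a
    using lab[OF that] by (auto simp: hom_odd_def hom_even_def nb)
  have "odd (card {a \<in> fibre ?H \<phi> v. hom_odd ?H G \<phi> a})" if v: "v \<in> pverts G" for v
  proof (cases "neighbourhood G v = {}")
    case True
    then have "{a \<in> fibre ?H \<phi> v. hom_odd ?H G \<phi> a} = {s v}"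
      using s[OF v] odd_iff by (auto simp: fibre_def S_def)
    then show ?thesis by simp
  next
    case False
    then have "{a \<in> fibre ?H \<phi> v. hom_odd ?H G \<phi> a} = A \<inter> fibre H \<phi> v"
      using odd_iff by (auto simp: fibre_def S_def)
    then show ?thesis using odd_fibre[OF v] by simp
  qed
  moreover have "graph_hom ?H G \<phi>"
    using hom by (auto simp: graph_hom_def pair_graph_induced)
  ultimately have "oddomorphism ?H G \<phi>"
    using odd_iff even_iff by (auto simp: oddomorphism_def)
  then show ?thesis
    using hom is_subgraph_induced[OF graphs(1)] by (auto simp: weak_oddomorphism_def)
qed

text \<open>Keeping \<open>H\<close> apart from \<open>F\<close> lets the bound speak of
  \<open>F\<close> while whole fibres are removed from \<open>H\<close> alone. The induction measure
  adds both sizes because some steps shrink only \<open>F\<close> and others only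
  \<open>G\<close>.\<close>

lemma elim_dist_le_if_labelled_oddomorphism:
  fixes \<F> :: "'a pair_pre_digraph set" and F G H :: "'a pair_pre_digraph"
  assumes "subgraph_closed \<F>" "weak_oddomorphism_closed \<F>"
    and "is_subgraph H F" "labelled_oddomorphism H G \<phi> A" "elim_dist \<F> F \<le> d"
  shows "elim_dist \<F> G \<le> d"
  using assms(3-)
proof (induction "card (pverts F) + card (pverts G)" arbitrary: F G H d rule: less_induct)
  case less
  note sub = \<open>is_subgraph H F\<close> and lab = \<open>labelled_oddomorphism H G \<phi> A\<close>
  have F: "pair_graph F" "pair_graph H" "pverts H \<subseteq> pverts F" "parcs H \<subseteq> parcs F"
    using sub by (auto simp: is_subgraph_iff)
  have hom: "graph_hom H G \<phi>" and G: "pair_graph G"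
    using lab by (auto simp: labelled_oddomorphism_def parity_labelling_def graph_hom_def)
  have sub_induced: "is_subgraph (induced H S) F" for S
    using F by (auto simp: is_subgraph_iff pair_graph_induced)
  show ?case
  \<comment> \<open>Both cases give the value 0: \<open>F\<close> in the class passes through
    \<open>H\<close> to \<open>G\<close> by the two closure properties.\<close>
  proof (cases "F \<in> \<F> \<or> pverts G = {}")
    case True
    then have "G \<in> \<F> \<or> pverts G = {}"
      using assms(1,2) sub labelled_oddomorphism_imp_weak_oddomorphism[OF lab]
      unfolding subgraph_closed_def weak_oddomorphism_closed_def by blast
    then show ?thesis
      using G by (simp add: elim_dist_eq_0)
  next
    case False
    then obtain u where "u \<in> pverts G"
      by auto
    \<comment> \<open>An odd number is not 0. That \<open>F\<close> is nonempty excludes the default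
      value 0 of \<open>elim_dist\<close>.\<close>
    then have "A \<inter> fibre H \<phi> u \<noteq> {}"
      using lab by (auto simp: labelled_oddomorphism_def)
    then have "pverts F \<noteq> {}"
      using F(3) by (auto simp: fibre_def)
    \<comment> \<open>\<open>G\<close> is split first, since choosing a component of
      \<open>F\<close> relies on a connected \<open>G\<close>.\<close>
    show ?thesis
    proof (cases "connected (with_proj G)")
      case G_disconnected: False
      show ?thesis
      proof (rule elim_dist_disconnected_leI[OF G G_disconnected])
        fix C assume C: "C \<in> components G"
        have "labelled_oddomorphism (induced H (\<phi> -` pverts C)) C \<phi> A"
          using labelled_oddomorphism_vimage[OF lab, of "pverts C"] componentD(4)[OF G C] by simp
        from less.hyps[OF _ sub_induced this less.prems(3)] card_component_less[OF G G_disconnected C]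
        show "elim_dist \<F> C \<le> d" by simp
      qed
    next
      case G_connected: True
      show ?thesis
      proof (cases "connected (with_proj F)")
        case F_disconnected: False
        \<comment> \<open>One component of \<open>F\<close> already carries all of \<open>G\<close>,
          and its elimination distance is at most that of \<open>F\<close>.\<close>
        obtain C where C: "C \<in> components F" "labelled_oddomorphism (induced H (pverts C)) G \<phi> A"
          using labelled_oddomorphism_component[OF lab sub G_connected] .
        have "parcs (induced H (pverts C)) \<subseteq> parcs C"
          by (subst (2) componentD(4)[OF F(1) C(1)]) (use F(4) in auto)
        then have sub_C: "is_subgraph (induced H (pverts C)) C"
          using F(2) componentD(1)[OF F(1) C(1)] by (auto simp: is_subgraph_iff pair_graph_induced)
        have "elim_dist \<F> C \<le> d"
          using elim_dist_component_le[OF F(1) _ \<open>pverts F \<noteq> {}\<close> F_disconnected C(1)] False less.prems(3)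
          by fastforce
        from less.hyps[OF _ sub_C C(2) this] card_component_less[OF F(1) F_disconnected C(1)]
        show ?thesis by simp
      next
        case F_connected: True
        obtain v where v: "v \<in> pverts F" "Suc (elim_dist \<F> (delete_vertex F v)) \<le> d"
          using elim_dist_connected_leD[OF F(1) _ F_connected less.prems(3)] False by blast
        note smaller = card_delete_vertex_less[OF F(1) v(1)]
        have sub_delete: "is_subgraph K (delete_vertex F v)"
          if "is_subgraph K H" "v \<notin> pverts K" for K
          using that F by (auto simp: is_subgraph_iff delete_vertex_eq_induced pair_graph_induced)
            (auto simp: pair_graph_iff)
        show ?thesis
        proof (cases "v \<in> pverts H")
          case True
          then have w: "\<phi> v \<in> pverts G"
            using hom by (auto simp: graph_hom_def)
          \<comment> \<open>The whole fibre over \<open>\<phi> v\<close> goes, and \<open>v\<close>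
            with it, so \<open>?K\<close> is a subgraph of \<open>delete_vertex F v\<close>.\<close>
          let ?K = "induced H (\<phi> -` (- {\<phi> v}))"
          have lab_K: "labelled_oddomorphism ?K (delete_vertex G (\<phi> v)) \<phi> A"
            using labelled_oddomorphism_vimage[OF lab] G by (simp only: delete_vertex_eq_induced)
          have sub_K: "is_subgraph ?K (delete_vertex F v)"
            using F(2) by (intro sub_delete is_subgraph_induced) auto
          have "elim_dist \<F> (delete_vertex G (\<phi> v)) \<le> elim_dist \<F> (delete_vertex F v)"
            using less.hyps[OF _ sub_K lab_K order_refl] smaller card_delete_vertex_less[OF G w] by simp
          then show ?thesis
            using v(2) by (intro elim_dist_connected_leI[OF G G_connected w]) simp
        next
          \<comment> \<open>Deleting \<open>v\<close> leaves \<open>H\<close> intact, so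
            \<open>G\<close> is kept and the bound even improves by one.\<close>
          case False
          then have "is_subgraph H (delete_vertex F v)"
            using F(2) by (intro sub_delete) (auto simp: is_subgraph_iff)
          from less.hyps[OF _ this lab order_refl] smaller
          have "elim_dist \<F> G \<le> elim_dist \<F> (delete_vertex F v)" by simp
          then show ?thesis
            using v(2) by simp
        qed
      qed
    qed
  qed
qed

theorem theorem3p6:
  fixes \<F> :: "'a pair_pre_digraph set" and d :: nat
  assumes "graph_class \<F>" and "subgraph_closed \<F>" and "weak_oddomorphism_closed \<F>"
  shows "weak_oddomorphism_closed {F. pair_graph F \<and> elim_dist \<F> F \<le> d}"
  unfolding weak_oddomorphism_closed_def
proof (intro allI impI, elim conjE exE)
  fix F G :: "'a pair_pre_digraph" and \<phi>
  assume F: "F \<in> {F. pair_graph F \<and> elim_dist \<F> F \<le> d}" and "weak_oddomorphism F G \<phi>"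
  \<comment> \<open>The subgraph \<open>H\<close> from the weak oddomorphism, labelled by its odd
    vertices, starts the induction.\<close>
  then obtain H where "is_subgraph H F" "oddomorphism H G \<phi>" "pair_graph G"
    by (auto simp: weak_oddomorphism_def graph_hom_def)
  then show "G \<in> {F. pair_graph F \<and> elim_dist \<F> F \<le> d}"
    using F elim_dist_le_if_labelled_oddomorphism[OF assms(2,3)] oddomorphism_imp_labelled by blast
qed

end
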